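(* Let $\Gamma\le\mathcal{S}_n$ be a symmetry group of $\min\{f(x):x\in\Phi\}$, $\Phi\subseteq\mathbb{R}^n$. Let $\mathcal{B}=(\mathcal{V},\mathcal{E})$ be a branch-and-bound tree using single variable branching with the branching-based symmetry prehandling structure (defined in the context). Let $\omega\in\mathcal{V}$ be a child of $\beta\in\mathcal{V}$ where $x_i$ is the branching variable for some $i\in\{1,\dots,n\}$. Then each solution $x\in\Phi(\omega)$ satisfying $\sigma_\omega(x)\succeq\sigma_\omega(\delta(x))$ for all $\delta\in\Gamma$ also satisfies $x_i\ge x_j$ for all $j\in O_i^\beta$, where $O_i^\beta=\{\gamma(i):\gamma\in\Delta^\beta\}$.
   Context: Permutations act on $x\in\mathbb{R}^n$ by $\gamma(x)=(x_{\gamma^{-1}(i)})_{i=1}^n$; symmetries preserve $f$ and membership in $\Phi$. The lexicographic order: $x\succ y$ if for some $k$ we have $x_i=y_i$ for $i<k$ and $x_k>y_k$; $x\succeq y$ if $x\succ y$ or $x=y$. For vectors of equal length, $x\le y$ means $x_i\le y_i$ for all $i$. Branching-based structure: for a node $\beta$, let $i_1,\dots,i_m$ be the distinct indices of the variables used in proper (standard) branching decisions on the path from the root to $\beta$, in the order in which they are first used for branching; then $m_\beta=m$ and $\sigma_\beta(x)=(x_{i_1},\dots,x_{i_m})$ for $x\in\mathbb{R}^n$ (void at the root). Node regions: the root has region $\Phi(\text{root})=\Phi$. A proper single variable branching at $\beta$ selects a variable $x_i$ (the branching variable) and partitions its domain; each child $\omega$ has region $\Phi(\omega)=\{x\in\Phi(\beta):x_i\in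 S_\omega\}$, where the sets $S_\omega$ partition the domain of $x_i$. In addition, there may be improper branchings, representing symmetry reductions: a set $C\subseteq\mathbb{R}^n$ containing every $x\in\Phi(\beta)$ with $\sigma_\beta(x)\succeq\sigma_\beta(\delta(x))$ for all $\delta\in\Gamma$ yields a child $\omega$ with $\Phi(\omega)=\Phi(\beta)\cap C$ and $\sigma_\omega=\sigma_\beta$ (the child with the complementary region $\Phi(\beta)\setminus C$ is pruned by symmetry). Let $W^\beta=\{x\in\mathbb{R}^n:\sigma_\beta(x)\succeq\sigma_\beta(\delta(x))\text{ for all }\delta\in\Gamma\}$ and $\Delta^\beta=\{\gamma\in\Gamma:\sigma_\beta(x)\le\sigma_\beta(\gamma(x))\text{ for all }x\in\Phi(\beta)\cap W^\beta\}$; the set $\Delta^\beta$ is a group. *)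

theory Defs
  imports
    "HOL-Analysis.Finite_Cartesian_Product"
    "HOL-Algebra.Bij"
    "HOL-Library.Disjoint_Sets"
begin

text \<open>The index set \<open>{1, \<dots>, n}\<close> is a finite type \<open>'n\<close>, so that \<open>S\<^sub>n\<close> is \<open>BijGroup UNIV\<close>.\<close>

definition perm_act :: "('n \<Rightarrow> 'n) \<Rightarrow> real ^ 'n::finite \<Rightarrow> real ^ 'n" where
  "perm_act \<gamma> x = (\<chi> i. x $ inv_into UNIV \<gamma> i)"

text \<open>The objective \<open>f\<close> only matters on the feasible region \<open>\<Phi>\<close>, so invariance of \<open>f\<close> is
  required there only.\<close>

definition symmetry_group ::
    "(real ^ 'n::finite \<Rightarrow> real) \<Rightarrow> (real ^ 'n) set \<Rightarrow> ('n \<Rightarrow> 'n) set \<Rightarrow> bool" where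
  "symmetry_group f \<Phi> \<Gamma> \<longleftrightarrow>
     subgroup \<Gamma> (BijGroup UNIV) \<and>
     (\<forall>\<gamma>\<in>\<Gamma>. (\<forall>x. perm_act \<gamma> x \<in> \<Phi> \<longleftrightarrow> x \<in> \<Phi>) \<and> (\<forall>x\<in>\<Phi>. f (perm_act \<gamma> x) = f x))"

text \<open>Vectors whose length varies from node to node are lists; the two relations below are only
  applied to lists of equal length.\<close>

definition lex_gt :: "real list \<Rightarrow> real list \<Rightarrow> bool" where
  "lex_gt u v \<longleftrightarrow> (\<exists>k<length u. (\<forall>i<k. u ! i = v ! i) \<and> u ! k > v ! k)"

definition lex_ge :: "real list \<Rightarrow> real list \<Rightarrow> bool" where
  "lex_ge u v \<longleftrightarrow> lex_gt u v \<or> u = v"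

datatype 'n branching = Unbranched | Proper 'n | Improper

text \<open>\<open>var_dom v i\<close> is the domain of \<open>x\<^sub>i\<close> at node \<open>v\<close>. If \<open>w\<close> is a child created by a proper
  branching, \<open>part w\<close> is the set \<open>S\<^sub>w\<close> to which the branching variable is restricted; otherwise
  \<open>part w\<close> is irrelevant.\<close>

record ('v, 'n) bb_tree =
  nodes :: "'v set"
  arcs :: "('v \<times> 'v) set"
  root :: 'v
  region :: "'v \<Rightarrow> (real ^ 'n) set"
  branching :: "'v \<Rightarrow> 'n branching"
  var_dom :: "'v \<Rightarrow> 'n \<Rightarrow> real set"
  part :: "'v \<Rightarrow> real set"

definition children :: "('v, 'n::finite) bb_tree \<Rightarrow> 'v \<Rightarrow> 'v set" where
  "children T v = {w. (v, w) \<in> arcs T}"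

definition rooted_tree :: "('v, 'n::finite) bb_tree \<Rightarrow> bool" where
  "rooted_tree T \<longleftrightarrow>
     root T \<in> nodes T \<and>
     arcs T \<subseteq> nodes T \<times> nodes T \<and>
     (\<forall>u. (u, root T) \<notin> arcs T) \<and>
     (\<forall>u u' v. (u, v) \<in> arcs T \<longrightarrow> (u', v) \<in> arcs T \<longrightarrow> u = u') \<and>
     (\<forall>v\<in>nodes T. (root T, v) \<in> (arcs T)\<^sup>*)"

definition root_path :: "('v, 'n::finite) bb_tree \<Rightarrow> 'v \<Rightarrow> 'v list" where
  "root_path T v = (THE p. p \<noteq> [] \<and> hd p = root T \<and> last p = v \<and>
                           successively (\<lambda>u w. (u, w) \<in> arcs T) p)"

fun proper_vars :: "'n branching \<Rightarrow> 'n list" where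
  "proper_vars (Proper i) = [i]"
| "proper_vars _ = []"

text \<open>The list \<open>[i\<^sub>1, \<dots>, i\<^sub>m]\<close>. The branching at \<open>v\<close> itself does not count, whence \<^const>\<open>butlast\<close>.
  As \<^const>\<open>remdups\<close> keeps last occurrences, it is conjugated by \<^const>\<open>rev\<close> to keep first ones.\<close>

definition branch_vars :: "('v, 'n::finite) bb_tree \<Rightarrow> 'v \<Rightarrow> 'n list" where
  "branch_vars T v =
     rev (remdups (rev (concat (map (\<lambda>u. proper_vars (branching T u)) (butlast (root_path T v))))))"

definition sigma :: "('v, 'n::finite) bb_tree \<Rightarrow> 'v \<Rightarrow> real ^ 'n \<Rightarrow> real list" where
  "sigma T v x = map (\<lambda>i. x $ i) (branch_vars T v)"

definition lexmax_set ::
    "('n \<Rightarrow> 'n) set \<Rightarrow> ('v, 'n::finite) bb_tree \<Rightarrow> 'v \<Rightarrow> (real ^ 'n) set" where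
  "lexmax_set \<Gamma> T v = {x. \<forall>\<delta>\<in>\<Gamma>. lex_ge (sigma T v x) (sigma T v (perm_act \<delta> x))}"

text \<open>Cells of the partition may be empty, and neither the tree nor the number of children is
  required to be finite.\<close>

definition proper_branching :: "('v, 'n::finite) bb_tree \<Rightarrow> 'v \<Rightarrow> 'n \<Rightarrow> bool" where
  "proper_branching T v i \<longleftrightarrow>
     disjoint_family_on (part T) (children T v) \<and>
     (\<Union>w\<in>children T v. part T w) = var_dom T v i \<and>
     (\<forall>w\<in>children T v. region T w = {x \<in> region T v. x $ i \<in> part T w})"

text \<open>The pruned child with the complementary region may be kept as a leaf or dropped.\<close>

definition improper_branching ::
    "('n \<Rightarrow> 'n) set \<Rightarrow> ('v, 'n::finite) bb_tree \<Rightarrow> 'v \<Rightarrow> bool" where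
  "improper_branching \<Gamma> T v \<longleftrightarrow>
     (\<exists>C w. region T v \<inter> lexmax_set \<Gamma> T v \<subseteq> C \<and>
        region T w = region T v \<inter> C \<and>
        (children T v = {w} \<or>
         (\<exists>w'. w' \<noteq> w \<and> children T v = {w, w'} \<and>
               region T w' = region T v - C \<and> branching T w' = Unbranched)))"

definition bb_tree_structure ::
    "(real ^ 'n::finite) set \<Rightarrow> ('n \<Rightarrow> 'n) set \<Rightarrow> ('v, 'n) bb_tree \<Rightarrow> bool" where
  "bb_tree_structure \<Phi> \<Gamma> T \<longleftrightarrow>
     rooted_tree T \<and>
     region T (root T) = \<Phi> \<and>
     (\<forall>v\<in>nodes T. \<forall>x\<in>region T v. \<forall>i. x $ i \<in> var_dom T v i) \<and>
     (\<forall>v\<in>nodes T. case branching T v of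
         Unbranched \<Rightarrow> children T v = {}
       | Proper i \<Rightarrow> proper_branching T v i
       | Improper \<Rightarrow> improper_branching \<Gamma> T v)"

definition Delta :: "('n \<Rightarrow> 'n) set \<Rightarrow> ('v, 'n::finite) bb_tree \<Rightarrow> 'v \<Rightarrow> ('n \<Rightarrow> 'n) set" where
  "Delta \<Gamma> T v =
     {\<gamma> \<in> \<Gamma>. \<forall>x \<in> region T v \<inter> lexmax_set \<Gamma> T v.
        list_all2 (\<le>) (sigma T v x) (sigma T v (perm_act \<gamma> x))}"

definition Delta_orbit ::
    "('n \<Rightarrow> 'n) set \<Rightarrow> ('v, 'n::finite) bb_tree \<Rightarrow> 'v \<Rightarrow> 'n \<Rightarrow> 'n set" where
  "Delta_orbit \<Gamma> T v i = {\<gamma> i |\<gamma>. \<gamma> \<in> Delta \<Gamma> T v}"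

end

theory Submission
  imports Defs
begin

text \<open>
  Let \<open>x\<close> be a point of the child's region that is lexicographically maximal at the child, let
  \<open>\<gamma>\<close> be an element of \<^const>\<open>Delta\<close> at the parent \<open>\<beta>\<close>, and let \<open>j = \<gamma> i\<close>. Since
  \<open>(\<gamma>\<^sup>-\<^sup>1 x)\<^sub>i = x\<^sub>j\<close>, the claim \<open>x\<^sub>i \<ge> x\<^sub>j\<close> is what lexicographic maximality against \<open>\<gamma>\<^sup>-\<^sup>1\<close> says in
  the entry of the new branching variable, provided that \<open>x\<close> and \<open>\<gamma>\<^sup>-\<^sup>1 x\<close> agree in all earlier
  entries, that is, \<open>\<sigma>\<^sub>\<beta>(\<gamma>\<^sup>-\<^sup>1 x) = \<sigma>\<^sub>\<beta>(x)\<close>. If \<open>x\<^sub>i\<close> was branched on before, this equation already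
  contains \<open>x\<^sub>j = x\<^sub>i\<close>.

  Everything thus rests on the equation for \<open>\<gamma>\<^sup>-\<^sup>1\<close> (lemma \<open>Delta_fixes_branch_vars\<close>). For \<open>\<gamma>\<close>
  itself it is immediate: \<open>\<sigma>\<^sub>\<beta>(x) \<le> \<sigma>\<^sub>\<beta>(\<gamma> x)\<close> holds entrywise by definition of \<^const>\<open>Delta\<close>, and
  \<open>\<sigma>\<^sub>\<beta>(x)\<close> is lexicographically at least \<open>\<sigma>\<^sub>\<beta>(\<gamma> x)\<close>. To pass to the inverse, one shows that \<open>\<gamma>\<close>
  maps the lexicographically maximal points of the region of \<open>\<beta>\<close> to such points
  (lemma \<open>Delta_preserves_lexmax_region\<close>). The equation can then be iterated to
  \<open>\<sigma>\<^sub>\<beta>(\<gamma>\<^sup>k x) = \<sigma>\<^sub>\<beta>(x)\<close> for all \<open>k\<close>, and an inverse in a finite group is a power.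

  The image \<open>\<gamma> x\<close> stays in the region of \<open>\<beta>\<close> for a structural reason
  (lemma \<open>region_depends_on_sigma\<close>): starting from \<open>\<Phi>\<close>, which \<open>\<gamma>\<close> preserves, the region shrinks
  along the root path only by conditions on variables in \<open>\<sigma>\<^sub>\<beta>\<close>, which \<open>\<gamma>\<close> leaves unchanged, and by
  sets \<open>C\<close> containing all lexicographically maximal points of the region at hand.
\<close>

section \<open>Permutations acting on coordinates\<close>

lemma symmetry_group_bij: "symmetry_group f \<Phi> \<Gamma> \<Longrightarrow> \<gamma> \<in> \<Gamma> \<Longrightarrow> bij \<gamma>"
  using subgroup.subset[of \<Gamma> "BijGroup UNIV"]
  by (auto simp: symmetry_group_def BijGroup_def Bij_def)

lemma symmetry_group_comp:
  assumes "symmetry_group f \<Phi> \<Gamma>" "\<gamma> \<in> \<Gamma>" "\<delta> \<in> \<Gamma>"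
  shows "\<gamma> \<circ> \<delta> \<in> \<Gamma>"
proof -
  have sub: "subgroup \<Gamma> (BijGroup UNIV)"
    using assms(1) by (simp add: symmetry_group_def)
  have "\<gamma> \<in> Bij UNIV" "\<delta> \<in> Bij UNIV"
    using assms symmetry_group_bij by (auto simp: Bij_def)
  then have "\<gamma> \<otimes>\<^bsub>BijGroup UNIV\<^esub> \<delta> = \<gamma> \<circ> \<delta>"
    by (simp add: BijGroup_def compose_def fun_eq_iff)
  then show ?thesis
    using subgroup.m_closed[OF sub assms(2,3)] by simp
qed

lemma symmetry_group_inv:
  assumes "symmetry_group f \<Phi> \<Gamma>" "\<gamma> \<in> \<Gamma>"
  shows "inv_into UNIV \<gamma> \<in> \<Gamma>"
proof -
  have sub: "subgroup \<Gamma> (BijGroup UNIV)"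
    using assms(1) by (simp add: symmetry_group_def)
  have "\<gamma> \<in> Bij UNIV"
    using assms symmetry_group_bij by (auto simp: Bij_def)
  then have "inv\<^bsub>BijGroup UNIV\<^esub> \<gamma> = inv_into UNIV \<gamma>"
    by (simp add: inv_BijGroup restrict_def)
  then show ?thesis
    using subgroup.m_inv_closed[OF sub assms(2)] by simp
qed

lemma perm_act_comp:
  assumes "bij \<gamma>" "bij \<delta>"
  shows "perm_act \<gamma> (perm_act \<delta> x) = perm_act (\<gamma> \<circ> \<delta>) x"
  using assms by (simp add: perm_act_def vec_eq_iff o_inv_distrib)

lemma perm_act_inv_nth: "bij \<gamma> \<Longrightarrow> perm_act (inv_into UNIV \<gamma>) x $ i = x $ \<gamma> i"
  by (simp add: perm_act_def inv_inv_eq)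

lemma perm_act_funpow_nth:
  assumes "bij \<gamma>"
  shows "(perm_act \<gamma> ^^ k) x $ (\<gamma> ^^ k) l = x $ l"
proof (induction k)
  case (Suc k)
  then show ?case
    using assms by (simp add: perm_act_def bij_is_inj)
qed simp

section \<open>Lexicographic comparison of prefixes\<close>

lemma lex_ge_append_left:
  assumes "lex_ge (u @ a) (v @ b)" "length u = length v"
  shows "lex_ge u v"
proof (cases "lex_gt (u @ a) (v @ b)")
  case True
  then obtain k where k: "k < length (u @ a)" "\<forall>i<k. (u @ a) ! i = (v @ b) ! i"
      "(u @ a) ! k > (v @ b) ! k"
    unfolding lex_gt_def by blast
  show ?thesis
  proof (cases "k < length u")
    case True
    moreover have "u ! i = v ! i" if "i < k" for i
      using k(2) that True assms(2) by (metis nth_append order.strict_trans)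
    moreover have "u ! k > v ! k"
      using k(3) True assms(2) by (simp add: nth_append)
    ultimately show ?thesis
      by (auto simp: lex_ge_def lex_gt_def)
  next
    case False
    have "u = v"
    proof (rule nth_equalityI[OF assms(2)])
      fix i assume "i < length u"
      then show "u ! i = v ! i"
        using k(2) False assms(2) by (metis nth_append order.strict_trans2 not_less)
    qed
    then show ?thesis by (simp add: lex_ge_def)
  qed
next
  case False
  then show ?thesis
    using assms by (simp add: lex_ge_def)
qed

lemma lex_ge_snoc_same:
  assumes "lex_ge (u @ [a]) (u @ [b])"
  shows "a \<ge> b"
proof (cases "lex_gt (u @ [a]) (u @ [b])")
  case True
  then obtain k where k: "k < length (u @ [a])" "(u @ [a]) ! k > (u @ [b]) ! k"
    unfolding lex_gt_def by blast
  then have "\<not> k < length u"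
    by (metis less_irrefl nth_append)
  then have "k = length u" using k(1) by simp
  then show ?thesis using k(2) by simp
next
  case False
  then show ?thesis using assms by (simp add: lex_ge_def)
qed

text \<open>At the first entry where the lists differ, the two hypotheses contradict each other.\<close>

lemma lex_ge_le_antisym:
  assumes "lex_ge u v" "list_all2 (\<le>) u v"
  shows "u = v"
proof -
  have "\<not> lex_gt u v"
    using list_all2_nthD[OF assms(2)] by (fastforce simp: lex_gt_def)
  then show ?thesis using assms(1) by (simp add: lex_ge_def)
qed

section \<open>Root paths and branching variables\<close>

lemma arc_source_in_nodes:
  assumes "rooted_tree T" "(u, v) \<in> arcs T"
  shows "u \<in> nodes T"
proof -
  have "arcs T \<subseteq> nodes T \<times> nodes T" using assms(1) by (simp add: rooted_tree_def)
  then show ?thesis using assms(2) by blast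
qed

text \<open>
  The predicate under the definite description in \<^const>\<open>root_path\<close>, which denotes a path only
  because existence and uniqueness hold in a rooted tree.
\<close>

definition is_root_path :: "('v, 'n::finite) bb_tree \<Rightarrow> 'v \<Rightarrow> 'v list \<Rightarrow> bool" where
  "is_root_path T v p \<longleftrightarrow> p \<noteq> [] \<and> hd p = root T \<and> last p = v \<and>
     successively (\<lambda>u w. (u, w) \<in> arcs T) p"

lemma is_root_path_snoc:
  "is_root_path T u p \<Longrightarrow> (u, v) \<in> arcs T \<Longrightarrow> is_root_path T v (p @ [v])"
  by (auto simp: is_root_path_def successively_append_iff)

lemma is_root_path_snocD:
  assumes "is_root_path T v (p @ [a])"
  shows "a = v" "p = [] \<Longrightarrow> v = root T"
    "p \<noteq> [] \<Longrightarrow> is_root_path T (last p) p \<and> (last p, v) \<in> arcs T"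
  using assms by (auto simp: is_root_path_def successively_append_iff)

lemma is_root_path_unique:
  assumes "rooted_tree T"
  shows "is_root_path T v p \<Longrightarrow> is_root_path T v q \<Longrightarrow> p = q"
proof (induction p arbitrary: v q rule: rev_induct)
  case Nil
  then show ?case by (simp add: is_root_path_def)
next
  case (snoc a p)
  have "q \<noteq> []" using snoc.prems(2) by (simp add: is_root_path_def)
  then obtain q' b where q: "q = q' @ [b]" by (cases q rule: rev_cases) auto
  note P = is_root_path_snocD[OF snoc.prems(1)]
  note Q = is_root_path_snocD[OF snoc.prems(2)[unfolded q]]
  have no_arc: "(u, root T) \<notin> arcs T" for u
    using assms by (simp add: rooted_tree_def)
  have one_arc: "u = u'" if "(u, v) \<in> arcs T" "(u', v) \<in> arcs T" for u u'
  proof -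
    have "\<forall>u u' v. (u, v) \<in> arcs T \<longrightarrow> (u', v) \<in> arcs T \<longrightarrow> u = u'"
      using assms by (simp add: rooted_tree_def)
    then show ?thesis using that by blast
  qed
  have "p = q'"
  proof (cases "p = [] \<or> q' = []")
    case True
    then have root: "v = root T" using P(2) Q(2) by blast
    have "p = []" using P(3) no_arc[of "last p"] unfolding root by blast
    moreover have "q' = []" using Q(3) no_arc[of "last q'"] unfolding root by blast
    ultimately show ?thesis by (rule trans[OF _ sym])
  next
    case False
    then have p: "is_root_path T (last p) p" "(last p, v) \<in> arcs T"
      and q': "is_root_path T (last q') q'" "(last q', v) \<in> arcs T"
      using P(3) Q(3) by blast+
    have "is_root_path T (last p) q'"
      using q'(1) one_arc[OF q'(2) p(2)] by argo
    then show ?thesis by (rule snoc.IH[OF p(1)])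
  qed
  moreover have "a = b" using P(1) Q(1) by (rule trans[OF _ sym])
  ultimately show ?case using q by blast
qed

lemma root_path_eqI:
  assumes "rooted_tree T" "is_root_path T v p"
  shows "root_path T v = p"
  unfolding root_path_def is_root_path_def[symmetric]
  using assms(2) is_root_path_unique[OF assms(1) _ assms(2)] by (rule the_equality)

lemma is_root_path_root_path:
  assumes "rooted_tree T" "v \<in> nodes T"
  shows "is_root_path T v (root_path T v)"
proof -
  have "(root T, v) \<in> (arcs T)\<^sup>*"
    using assms by (simp add: rooted_tree_def)
  then have "\<exists>p. is_root_path T v p"
  proof induction
    case base
    have "is_root_path T (root T) [root T]" by (simp add: is_root_path_def)
    then show ?case by blast
  qed (blast intro: is_root_path_snoc)
  then obtain p where "is_root_path T v p" ..
  then show ?thesis by (simp add: root_path_eqI[OF assms(1)])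
qed

lemma root_path_child:
  assumes "rooted_tree T" "(u, v) \<in> arcs T"
  shows "root_path T v = root_path T u @ [v]"
proof -
  have "u \<in> nodes T" using arc_source_in_nodes[OF assms] .
  then have "is_root_path T v (root_path T u @ [v])"
    by (rule is_root_path_snoc[OF is_root_path_root_path[OF assms(1)] assms(2)])
  then show ?thesis by (rule root_path_eqI[OF assms(1)])
qed

text \<open>
  This recursion along arcs replaces the definition of \<^const>\<open>branch_vars\<close> from here on. It makes
  \<open>\<sigma>\<close> of a node a prefix of \<open>\<sigma>\<close> of its children, so that lexicographic maximality at a node is
  inherited by all its ancestors.
\<close>

lemma branch_vars_child:
  assumes "rooted_tree T" "(u, v) \<in> arcs T"
  shows "branch_vars T v = branch_vars T u @
           filter (\<lambda>i. i \<notin> set (branch_vars T u)) (proper_vars (branching T u))"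
proof -
  have "u \<in> nodes T" using arc_source_in_nodes[OF assms] .
  then have "root_path T u \<noteq> []" "last (root_path T u) = u"
    using is_root_path_root_path[OF assms(1)] by (simp_all add: is_root_path_def)
  then obtain p where p: "root_path T u = p @ [u]"
    by (metis append_butlast_last_id)
  show ?thesis
    using root_path_child[OF assms] p
    by (cases "branching T u") (auto simp: branch_vars_def butlast_append)
qed

lemma sigma_eq_iff: "sigma T v x = sigma T v y \<longleftrightarrow> (\<forall>l\<in>set (branch_vars T v). x $ l = y $ l)"
  by (simp add: sigma_def)

lemma lexmax_set_child_subset:
  assumes "rooted_tree T" "(u, v) \<in> arcs T"
  shows "lexmax_set \<Gamma> T v \<subseteq> lexmax_set \<Gamma> T u"
proof -
  have "lex_ge (sigma T u x) (sigma T u y)" if "lex_ge (sigma T v x) (sigma T v y)" for x y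
  proof (rule lex_ge_append_left)
    let ?new = "filter (\<lambda>i. i \<notin> set (branch_vars T u)) (proper_vars (branching T u))"
    show "lex_ge (sigma T u x @ map (($) x) ?new) (sigma T u y @ map (($) y) ?new)"
      using that branch_vars_child[OF assms] by (simp add: sigma_def)
  qed (simp add: sigma_def)
  then show ?thesis by (auto simp: lexmax_set_def)
qed

section \<open>Symmetries in Delta preserve the lexicographically maximal region\<close>

text \<open>
  The node must have been branched on: this excludes the leaves left over from improper branchings,
  whose complementary regions need not be closed under the exchange of \<open>x\<close> for \<open>y\<close>. No proper ancestor
  of any node is such a leaf, so the induction along the root path goes through.
\<close>

lemma region_depends_on_sigma:
  assumes T: "bb_tree_structure \<Phi> \<Gamma> T"
    and "v \<in> nodes T" "branching T v \<noteq> Unbranched"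
    and "x \<in> region T v" "y \<in> \<Phi>" "y \<in> lexmax_set \<Gamma> T v" "sigma T v x = sigma T v y"
  shows "y \<in> region T v"
proof -
  have rt: "rooted_tree T" and root: "region T (root T) = \<Phi>"
    using T by (auto simp: bb_tree_structure_def)
  have "(root T, v) \<in> (arcs T)\<^sup>*"
    using rt assms(2) by (simp add: rooted_tree_def)
  then show ?thesis
    using assms(3-)
  proof induction
    case base
    then show ?case using root by simp
  next
    case (step u v)
    have u: "u \<in> nodes T" using arc_source_in_nodes[OF rt step.hyps(2)] .
    have child: "v \<in> children T u" using step.hyps(2) by (simp add: children_def)
    have node: "case branching T u of Unbranched \<Rightarrow> children T u = {}
        | Proper i \<Rightarrow> proper_branching T u i | Improper \<Rightarrow> improper_branching \<Gamma> T u"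
      using T u by (simp add: bb_tree_structure_def)
    have lexmax: "y \<in> lexmax_set \<Gamma> T u"
      using lexmax_set_child_subset[OF rt step.hyps(2)] step.prems by blast
    note bv = branch_vars_child[OF rt step.hyps(2)]
    have sig: "sigma T u x = sigma T u y"
      using step.prems(5) bv by (auto simp: sigma_eq_iff)
    have "branching T u \<noteq> Unbranched" using node child by auto
    then have IH: "y \<in> region T u" if "x \<in> region T u"
      using step.IH that step.prems(3) lexmax sig by blast
    show ?case
    proof (cases "branching T u")
      case Unbranched
      then show ?thesis using node child by simp
    next
      case (Proper i)
      have reg: "region T v = {x \<in> region T u. x $ i \<in> part T v}"
        using node Proper child by (simp add: proper_branching_def)
      have "i \<in> set (branch_vars T v)"
        using bv Proper by auto
      then have "x $ i = y $ i"
        using step.prems(5) by (simp add: sigma_eq_iff)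
      then show ?thesis using reg IH step.prems by auto
    next
      case Improper
      then obtain C where C: "region T u \<inter> lexmax_set \<Gamma> T u \<subseteq> C" "region T v = region T u \<inter> C"
        using node child step.prems(1) by (auto simp: improper_branching_def)
      then show ?thesis using IH step.prems lexmax by blast
    qed
  qed
qed

lemma Delta_preserves_sigma:
  assumes "\<gamma> \<in> Delta \<Gamma> T v" "x \<in> region T v \<inter> lexmax_set \<Gamma> T v"
  shows "sigma T v (perm_act \<gamma> x) = sigma T v x"
proof -
  have "\<gamma> \<in> \<Gamma>" and le: "list_all2 (\<le>) (sigma T v x) (sigma T v (perm_act \<gamma> x))"
    using assms by (auto simp: Delta_def)
  then have "lex_ge (sigma T v x) (sigma T v (perm_act \<gamma> x))"
    using assms(2) by (auto simp: lexmax_set_def)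
  then show ?thesis using lex_ge_le_antisym[OF _ le] by simp
qed

lemma Delta_preserves_lexmax_region:
  assumes sym: "symmetry_group f \<Phi> \<Gamma>" and T: "bb_tree_structure \<Phi> \<Gamma> T"
    and v: "v \<in> nodes T" "branching T v \<noteq> Unbranched"
    and \<gamma>: "\<gamma> \<in> Delta \<Gamma> T v" and x: "x \<in> \<Phi>" "x \<in> region T v \<inter> lexmax_set \<Gamma> T v"
  shows "perm_act \<gamma> x \<in> region T v \<inter> lexmax_set \<Gamma> T v"
proof -
  have \<gamma>\<Gamma>: "\<gamma> \<in> \<Gamma>" using \<gamma> by (simp add: Delta_def)
  note sig = Delta_preserves_sigma[OF \<gamma> x(2)]
  \<comment> \<open>The points \<open>x\<close> and \<open>\<gamma> x\<close> have the same \<open>\<Gamma>\<close>-orbit and the same \<open>\<sigma>\<close>.\<close>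
  have "lex_ge (sigma T v (perm_act \<gamma> x)) (sigma T v (perm_act \<delta> (perm_act \<gamma> x)))"
    if "\<delta> \<in> \<Gamma>" for \<delta>
  proof -
    have "perm_act \<delta> (perm_act \<gamma> x) = perm_act (\<delta> \<circ> \<gamma>) x"
      using perm_act_comp symmetry_group_bij[OF sym] that \<gamma>\<Gamma> by blast
    moreover have "\<delta> \<circ> \<gamma> \<in> \<Gamma>"
      using symmetry_group_comp[OF sym that \<gamma>\<Gamma>] .
    ultimately show ?thesis
      using x(2) sig by (simp add: lexmax_set_def)
  qed
  then have lexmax: "perm_act \<gamma> x \<in> lexmax_set \<Gamma> T v"
    by (simp add: lexmax_set_def)
  have "perm_act \<gamma> x \<in> \<Phi>"
    using sym \<gamma>\<Gamma> x(1) by (simp add: symmetry_group_def)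
  then have "perm_act \<gamma> x \<in> region T v"
    using region_depends_on_sigma[OF T v] x(2) lexmax sig by auto
  with lexmax show ?thesis by blast
qed

lemma region_subset:
  assumes "bb_tree_structure \<Phi> \<Gamma> T" "v \<in> nodes T"
  shows "region T v \<subseteq> \<Phi>"
proof -
  have rt: "rooted_tree T" and root: "region T (root T) = \<Phi>"
    using assms(1) by (auto simp: bb_tree_structure_def)
  have "(root T, v) \<in> (arcs T)\<^sup>*"
    using rt assms(2) by (simp add: rooted_tree_def)
  then show ?thesis
  proof induction
    case base
    then show ?case using root by simp
  next
    case (step u v)
    have "u \<in> nodes T" using arc_source_in_nodes[OF rt step.hyps(2)] .
    then have "case branching T u of Unbranched \<Rightarrow> children T u = {}
        | Proper i \<Rightarrow> proper_branching T u i | Improper \<Rightarrow> improper_branching \<Gamma> T u"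
      using assms(1) by (simp add: bb_tree_structure_def)
    moreover have "v \<in> children T u" using step.hyps(2) by (simp add: children_def)
    ultimately have "region T v \<subseteq> region T u"
      by (cases "branching T u") (auto simp: proper_branching_def improper_branching_def)
    then show ?case using step.IH by blast
  qed
qed

text \<open>
  In terms of \<open>\<sigma>\<close> the conclusion reads \<open>\<sigma>(\<gamma>\<^sup>-\<^sup>1 x) = \<sigma>(x)\<close>. If the cycle of \<open>\<gamma>\<close> through \<open>l\<close> has length
  dividing \<open>k + 1\<close>, then \<open>\<gamma>\<^sup>k\<close> maps \<open>\<gamma> l\<close> back to \<open>l\<close>, so \<open>x\<close> has at \<open>\<gamma> l\<close> the entry that \<open>\<gamma>\<^sup>k x\<close>
  has at \<open>l\<close>.
\<close>

lemma Delta_fixes_branch_vars: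
  assumes sym: "symmetry_group f \<Phi> \<Gamma>" and T: "bb_tree_structure \<Phi> \<Gamma> T"
    and v: "v \<in> nodes T" "branching T v \<noteq> Unbranched"
    and \<gamma>: "\<gamma> \<in> Delta \<Gamma> T v" and x: "x \<in> region T v \<inter> lexmax_set \<Gamma> T v"
    and l: "l \<in> set (branch_vars T v)"
  shows "x $ \<gamma> l = x $ l"
proof -
  have bij: "bij \<gamma>"
    using \<gamma> symmetry_group_bij[OF sym] by (simp add: Delta_def)
  have iter: "(perm_act \<gamma> ^^ k) x \<in> region T v \<inter> lexmax_set \<Gamma> T v \<and>
      sigma T v ((perm_act \<gamma> ^^ k) x) = sigma T v x" for k
  proof (induction k)
    case 0
    then show ?case using x by simp
  next
    case (Suc k)
    have "(perm_act \<gamma> ^^ k) x \<in> \<Phi>"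
      using Suc region_subset[OF T v(1)] by blast
    then show ?case
      using Suc Delta_preserves_sigma[OF \<gamma>] Delta_preserves_lexmax_region[OF sym T v \<gamma>] by auto
  qed
  obtain n where n: "n > 0" "(\<gamma> ^^ n) l = l"
    using funpow_inj_finite[OF bij_is_inj[OF bij], of l] by auto
  then obtain k where "n = Suc k"
    using gr0_implies_Suc by blast
  then have "(\<gamma> ^^ k) (\<gamma> l) = l"
    using n by (simp add: funpow_swap1)
  then have "x $ \<gamma> l = (perm_act \<gamma> ^^ k) x $ l"
    using perm_act_funpow_nth[OF bij, of k x "\<gamma> l"] by simp
  also have "\<dots> = x $ l"
    using iter[of k] l by (simp add: sigma_eq_iff)
  finally show ?thesis .
qed

section \<open>Orbit inequalities at a proper branching\<close>

theorem lemma23: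
  fixes f :: "real ^ 'n::finite \<Rightarrow> real"
    and \<Phi> :: "(real ^ 'n) set"
    and \<Gamma> :: "('n \<Rightarrow> 'n) set"
    and T :: "('v, 'n) bb_tree"
    and \<beta> \<omega> :: 'v
    and i :: 'n
  assumes "symmetry_group f \<Phi> \<Gamma>"
    and "bb_tree_structure \<Phi> \<Gamma> T"
    and "\<beta> \<in> nodes T" and "\<omega> \<in> children T \<beta>"
    and "branching T \<beta> = Proper i"
  shows "\<forall>x \<in> region T \<omega>.
           (\<forall>\<delta>\<in>\<Gamma>. lex_ge (sigma T \<omega> x) (sigma T \<omega> (perm_act \<delta> x))) \<longrightarrow>
           (\<forall>j \<in> Delta_orbit \<Gamma> T \<beta> i. x $ i \<ge> x $ j)"
proof (intro ballI impI)
  fix x j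
  assume x: "x \<in> region T \<omega>" and "j \<in> Delta_orbit \<Gamma> T \<beta> i"
    and lex: "\<forall>\<delta>\<in>\<Gamma>. lex_ge (sigma T \<omega> x) (sigma T \<omega> (perm_act \<delta> x))"
  then obtain \<gamma> where \<gamma>: "\<gamma> \<in> Delta \<Gamma> T \<beta>" and j: "j = \<gamma> i"
    by (auto simp: Delta_orbit_def)
  have rt: "rooted_tree T" and "proper_branching T \<beta> i"
    using assms(2,3,5) by (force simp: bb_tree_structure_def)+
  then have x\<beta>: "x \<in> region T \<beta>"
    using x assms(4) by (auto simp: proper_branching_def)
  have arc: "(\<beta>, \<omega>) \<in> arcs T"
    using assms(4) by (simp add: children_def)
  have "x \<in> lexmax_set \<Gamma> T \<beta>"
    using lexmax_set_child_subset[OF rt arc, of \<Gamma>] lex by (auto simp: lexmax_set_def)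
  then have fixed: "x $ \<gamma> l = x $ l" if "l \<in> set (branch_vars T \<beta>)" for l
    using Delta_fixes_branch_vars[OF assms(1-3) _ \<gamma> _ that] x\<beta> assms(5) by simp
  show "x $ i \<ge> x $ j"
  proof (cases "i \<in> set (branch_vars T \<beta>)")
    case True
    then show ?thesis using fixed j by simp
  next
    case False
    then have sig: "sigma T \<omega> y = sigma T \<beta> y @ [y $ i]" for y
      using branch_vars_child[OF rt arc] assms(5) by (simp add: sigma_def)
    have "\<gamma> \<in> \<Gamma>" using \<gamma> by (simp add: Delta_def)
    then have bij: "bij \<gamma>" and "inv_into UNIV \<gamma> \<in> \<Gamma>"
      using symmetry_group_bij[OF assms(1)] symmetry_group_inv[OF assms(1)] by auto
    moreover have "sigma T \<beta> (perm_act (inv_into UNIV \<gamma>) x) = sigma T \<beta> x"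
      using fixed by (simp add: sigma_eq_iff perm_act_inv_nth[OF bij])
    ultimately have "lex_ge (sigma T \<beta> x @ [x $ i]) (sigma T \<beta> x @ [x $ j])"
      using lex sig j by (metis perm_act_inv_nth)
    then show ?thesis by (rule lex_ge_snoc_same)
  qed
qed

end
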